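(* If $G$ is a finite soluble group, then $\psi(G)\leq d(G)+1$.
   Context: For a finite group $G$, $d(G)$ denotes the minimum number of generators of $G$. Define $x\equiv_{\mathrm m} y$ for $x,y\in G$ if $x$ and $y$ lie in exactly the same maximal subgroups of $G$. For a positive integer $r$, define $x\equiv_{\mathrm m}^{(r)}y$ if for all $z_1,\ldots,z_{r-1}\in G$ one has $\langle x,z_1,\ldots,z_{r-1}\rangle=G$ if and only if $\langle y,z_1,\ldots,z_{r-1}\rangle=G$. These equivalence relations become finer as $r$ increases and eventually equal $\equiv_{\mathrm m}$; $\psi(G)$ denotes the least positive integer $r$ such that $\equiv_{\mathrm m}^{(r)}$ coincides with $\equiv_{\mathrm m}$. *)

theory Defs
  imports "HOL-Algebra.Solvable_Groups"
begin

definition maximal_subgroup :: "'a set \<Rightarrow> ('a, 'b) monoid_scheme \<Rightarrow> bool" where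
  "maximal_subgroup M G \<longleftrightarrow> subgroup M G \<and> M \<noteq> carrier G \<and>
     (\<forall>H. subgroup H G \<and> M \<subseteq> H \<longrightarrow> H = M \<or> H = carrier G)"

(* For finite carriers the set of candidates contains card (carrier G), so the minimum is attained.
   The trivial group has min_generators = 0, witnessed by the empty set. *)
definition min_generators :: "('a, 'b) monoid_scheme \<Rightarrow> nat" where
  "min_generators G =
     (LEAST n. \<exists>S \<subseteq> carrier G. finite S \<and> card S = n \<and> generate G S = carrier G)"

definition equiv_max :: "('a, 'b) monoid_scheme \<Rightarrow> 'a \<Rightarrow> 'a \<Rightarrow> bool" where
  "equiv_max G x y \<longleftrightarrow> x \<in> carrier G \<and> y \<in> carrier G \<and>
     (\<forall>M. maximal_subgroup M G \<longrightarrow> (x \<in> M \<longleftrightarrow> y \<in> M))"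

(* The tuple (z_1, ..., z_{r-1}), repetitions allowed, is the list zs. Only r > 0 is meaningful. *)
definition equiv_max_r :: "('a, 'b) monoid_scheme \<Rightarrow> nat \<Rightarrow> 'a \<Rightarrow> 'a \<Rightarrow> bool" where
  "equiv_max_r G r x y \<longleftrightarrow> x \<in> carrier G \<and> y \<in> carrier G \<and>
     (\<forall>zs. set zs \<subseteq> carrier G \<and> length zs = r - 1 \<longrightarrow>
        (generate G (insert x (set zs)) = carrier G \<longleftrightarrow>
         generate G (insert y (set zs)) = carrier G))"

(* For a finite group the minimum is attained: once r - 1 is at least card (carrier G),
   zs can enumerate any maximal subgroup, and the two relations coincide. *)
definition psi :: "('a, 'b) monoid_scheme \<Rightarrow> nat" where
  "psi G = (LEAST r. r > 0 \<and> equiv_max_r G r = equiv_max G)"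

end

theory Submission
  imports Defs "HOL-Algebra.Zassenhaus"
begin

text \<open>
  Only one implication is substantial: if \<open>M\<close> is maximal and \<open>y \<notin> M\<close>, then \<open>y\<close> together with
  \<open>d(G)\<close> suitable elements of \<open>M\<close> generates \<open>G\<close>. Choose \<open>N\<close> minimal among the normal subgroups not
  contained in \<open>M\<close>. Then \<open>N'\<close> lies in \<open>M\<close>, so \<open>K = N \<inter> M\<close> is normal in \<open>G = N M\<close>, and the
  \<open>M\<close>-components \<open>m\<^sub>i\<close> of generators \<open>g\<^sub>i\<close> of \<open>G\<close> satisfy \<open>\<langle>y, m\<^sub>1, \<dots>, m\<^sub>d\<rangle> K = G\<close>. A variant of
  Gaschuetz' lemma with \<open>y\<close> kept fixed now replaces every \<open>m\<^sub>i\<close> by an element of \<open>K m\<^sub>i \<subseteq> M\<close>.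

  For a chief factor \<open>K / L\<close> the variant is a counting argument: each bad tuple \<open>(a\<^sub>i)\<close> in
  \<open>(K / L)\<^sup>d\<close> yields a complement \<open>\<langle>y, a\<^sub>i m\<^sub>i\<rangle> L\<close> of \<open>K\<close> modulo \<open>L\<close>, and a complement is in turn
  determined by the unique tuple \<open>(b\<^sub>i)\<close> for which it contains all \<open>b\<^sub>i g\<^sub>i\<close>. If all tuples were bad,
  \<open>a \<mapsto> b\<close> would be an injective self-map of \<open>(K / L)\<^sup>d\<close>. But it misses the trivial tuple, since no
  complement contains all the \<open>g\<^sub>i\<close>.
\<close>

section \<open>Products of subgroups, derived subgroups and coset representatives\<close>

lemma mem_set_mult_iff: "x \<in> H <#>\<^bsub>G\<^esub> K \<longleftrightarrow> (\<exists>h\<in>H. \<exists>k\<in>K. x = h \<otimes>\<^bsub>G\<^esub> k)"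
  by (auto simp: set_mult_def)

context group
begin

lemma set_mult_eq_carrierI:
  assumes "K \<lhd> G" "subgroup H G" "generate G S = carrier G" "S \<subseteq> K <#> H"
  shows "K <#> H = carrier G"
proof -
  have "subgroup (K <#> H) G"
    using assms(1,2) by (rule mult_norm_subgroup)
  then show ?thesis
    using generate_subgroup_incl[OF assms(4)] assms(3) subgroup.subset by blast
qed

lemma subset_set_mult1:
  assumes "K \<subseteq> carrier G" "subgroup H G"
  shows "K \<subseteq> K <#> H"
proof
  fix k assume "k \<in> K"
  then have "k = k \<otimes> \<one>" "\<one> \<in> H"
    using assms subgroup.one_closed by auto
  then show "k \<in> K <#> H"
    using \<open>k \<in> K\<close> unfolding mem_set_mult_iff by blast
qed

lemma subset_set_mult2:
  assumes "subgroup K G" "H \<subseteq> carrier G"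
  shows "H \<subseteq> K <#> H"
proof
  fix h assume "h \<in> H"
  then have "h = \<one> \<otimes> h" "\<one> \<in> K"
    using assms subgroup.one_closed by auto
  then show "h \<in> K <#> H"
    using \<open>h \<in> H\<close> unfolding mem_set_mult_iff by blast
qed

text \<open>Dedekind's modular law: in \<open>h = k \<otimes> r\<close> the factor
  \<open>k = h \<otimes> inv r\<close> lies in \<open>K \<inter> H\<close>, hence in
  \<open>R\<close>.\<close>

lemma modular_subgroup_subset:
  assumes "subgroup H G" "subgroup R G" "R \<subseteq> H" "H \<subseteq> K <#> R" "K \<inter> H \<subseteq> R"
    "K \<subseteq> carrier G"
  shows "H \<subseteq> R"
proof
  fix h assume h: "h \<in> H"
  then obtain k r where kr: "k \<in> K" "r \<in> R" "h = k \<otimes> r"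
    using assms(4) mem_set_mult_iff[of h G K R] by blast
  have car: "k \<in> carrier G" "r \<in> carrier G"
    using kr assms(2,6) subgroup.subset by blast+
  then have "k = h \<otimes> inv r"
    using kr(3) by (simp add: m_assoc)
  then have "k \<in> H"
    using h kr(2) assms(1,3) by (metis subgroup.m_closed subgroup.m_inv_closed subsetD)
  then show "h \<in> R"
    using kr assms(2,5) by (metis IntI subgroup.m_closed subsetD)
qed

text \<open>Since \<open>G = K H\<close>, two kinds of conjugation suffice. Elements of
  \<open>H\<close> preserve \<open>K \<inter> H\<close>, and elements of \<open>K\<close> change a
  member only by a commutator from \<open>derived G K\<close>, which lies in
  \<open>H\<close>.\<close>

lemma normal_Int_of_derived_subset:
  assumes K: "K \<lhd> G" and H: "subgroup H G" and der: "derived G K \<subseteq> H"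
    and KH: "K <#> H = carrier G"
  shows "K \<inter> H \<lhd> G"
proof (rule normal_invI)
  interpret K: normal K G by fact
  show "subgroup (K \<inter> H) G"
    using K.subgroup_axioms H by (rule subgroups_Inter_pair)
  fix x u assume x: "x \<in> carrier G" and u: "u \<in> K \<inter> H"
  obtain k h where kh: "k \<in> K" "h \<in> H" "x = k \<otimes> h"
    using x KH mem_set_mult_iff[of x G K H] by auto
  have car: "k \<in> carrier G" "h \<in> carrier G" "u \<in> carrier G"
    using kh u K.subset subgroup.subset[OF H] by blast+
  define v where "v = h \<otimes> u \<otimes> inv h"
  have v: "v \<in> K" "v \<in> H" "v \<in> carrier G"
    using K.inv_op_closed2[of h u] car u kh(2) H unfolding v_def
    by (auto intro!: subgroup.m_closed subgroup.m_inv_closed)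
  have "k \<otimes> v \<otimes> inv k \<otimes> inv v \<in> derived G K"
    unfolding derived_def using kh(1) v(1) by (blast intro: generate.incl)
  then have "k \<otimes> v \<otimes> inv k \<otimes> inv v \<in> H"
    using der by blast
  then have "k \<otimes> v \<otimes> inv k \<otimes> inv v \<otimes> v \<in> H"
    using v(2) H subgroup.m_closed by metis
  moreover have "k \<otimes> v \<otimes> inv k \<otimes> inv v \<otimes> v = k \<otimes> v \<otimes> inv k"
    using car v(3) by (simp add: m_assoc)
  moreover have "k \<otimes> v \<otimes> inv k = x \<otimes> u \<otimes> inv x"
    using car unfolding kh(3) v_def by (simp add: m_assoc inv_mult_group)
  ultimately show "x \<otimes> u \<otimes> inv x \<in> K \<inter> H"
    using K.inv_op_closed2[OF x, of u] u by auto
qed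

lemma derived_psubset_of_solvable:
  assumes "solvable G" "subgroup H G" "H \<noteq> {\<one>}"
  shows "derived G H \<subset> H"
proof -
  obtain n where n: "(derived G ^^ n) H = {\<one>}"
    using solvable_imp_trivial_derived_seq[OF solvable_subgroup[OF assms(2,1)]] by blast
  have "derived G H \<noteq> H"
  proof
    assume fixed: "derived G H = H"
    have "(derived G ^^ n) H = H"
      by (induction n) (simp_all add: fixed)
    with n assms(3) show False by simp
  qed
  then show ?thesis
    using derived_incl[OF order_refl assms(2)] by blast
qed

text \<open>\<open>T\<close> stands in for the quotient \<open>K / L\<close>, so that tuples over a
  chief factor can be counted as functions with values in \<open>G\<close>.\<close>

lemma rcoset_transversal_exists:
  assumes L: "subgroup L G" and LK: "L \<subseteq> K" and K: "subgroup K G"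
  obtains T where "T \<subseteq> K" "\<And>k. k \<in> K \<Longrightarrow> \<exists>t\<in>T. t \<otimes> inv k \<in> L"
    "\<And>s t. s \<in> T \<Longrightarrow> t \<in> T \<Longrightarrow> s \<otimes> inv t \<in> L \<Longrightarrow> s = t"
proof -
  have LG: "L \<subseteq> carrier G" and KG: "K \<subseteq> carrier G"
    using L K by (auto dest: subgroup.subset)
  \<comment> \<open>The choice depends only on the coset as a set, so equal cosets get the same
    representative.\<close>
  define rep where "rep k = (SOME t. t \<in> L #> k)" for k
  have rep: "rep k \<in> L #> k" if "k \<in> K" for k
    unfolding rep_def by (rule someI[of _ k], rule rcos_self[OF _ L]) (use that KG in blast)
  have rep_K: "rep k \<in> K" if k: "k \<in> K" for k
  proof -
    obtain h where "h \<in> L" "rep k = h \<otimes> k"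
      using rep[OF k] unfolding r_coset_def by blast
    then show ?thesis
      using k LK subgroup.m_closed[OF K] by auto
  qed
  have cosets: "L #> rep k = L #> k" if "k \<in> K" for k
    using repr_independence[OF rep[OF that] _ L] that KG by blast
  have mem: "x \<in> L #> y \<longleftrightarrow> x \<otimes> inv y \<in> L" if "x \<in> K" "y \<in> K" for x y
    using subgroup.rcos_module[OF L is_group] that KG by blast
  show thesis
  proof (rule that)
    show "rep ` K \<subseteq> K"
      using rep_K by blast
    show "\<exists>t\<in>rep ` K. t \<otimes> inv k \<in> L" if "k \<in> K" for k
      using mem[OF rep_K[OF that] that] rep[OF that] that by blast
    fix s t assume st: "s \<in> rep ` K" "t \<in> rep ` K" "s \<otimes> inv t \<in> L"
    then obtain j k where jk: "j \<in> K" "s = rep j" "k \<in> K" "t = rep k"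
      by blast
    have "s \<in> L #> t"
      using mem st(3) jk rep_K by blast
    then have "L #> t = L #> s"
      using repr_independence[OF _ _ L] jk rep_K KG by blast
    then have "L #> j = L #> k"
      using cosets jk by simp
    then show "s = t"
      using jk by (simp add: rep_def)
  qed
qed

section \<open>Gaschuetz' lemma with a fixed part of the generating set\<close>

text \<open>The counting argument for one chief factor; the generators in \<open>Y\<close> stay
  untouched. The factor is abelian by \<open>der\<close> and irreducible by \<open>chief\<close>,
  which makes every proper supplement of \<open>K\<close> containing \<open>L\<close> a complement
  modulo \<open>L\<close>.\<close>

lemma chief_factor_lift:
  fixes g z :: "'i \<Rightarrow> 'a"
  assumes fin: "finite (carrier G)" and I: "finite I"
    and K: "K \<lhd> G" and L: "L \<lhd> G" and LK: "L \<subset> K" and der: "derived G K \<subseteq> L"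
    and chief: "\<And>N. N \<lhd> G \<Longrightarrow> L \<subseteq> N \<Longrightarrow> N \<subseteq> K \<Longrightarrow> N = L \<or> N = K"
    and g: "g \<in> I \<rightarrow> carrier G" and gen_g: "generate G (g ` I) = carrier G"
    and z: "z \<in> I \<rightarrow> carrier G" and Y: "Y \<subseteq> carrier G"
    and gen_z: "generate G (Y \<union> z ` I \<union> K) = carrier G"
  shows "\<exists>a\<in>I \<rightarrow> K. generate G (Y \<union> (\<lambda>i. a i \<otimes> z i) ` I \<union> L) = carrier G"
proof (rule ccontr)
  assume no_lift: "\<not> ?thesis"
  have subK: "subgroup K G" and subL: "subgroup L G"
    using K L normal_imp_subgroup by auto
  have KG: "K \<subseteq> carrier G" and LG: "L \<subseteq> carrier G"
    using subK subL subgroup.subset by auto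
  obtain T where TK: "T \<subseteq> K" and T: "\<And>k. k \<in> K \<Longrightarrow> \<exists>t\<in>T. t \<otimes> inv k \<in> L"
    and T_unique: "\<And>s t. s \<in> T \<Longrightarrow> t \<in> T \<Longrightarrow> s \<otimes> inv t \<in> L \<Longrightarrow> s = t"
    using rcoset_transversal_exists[OF subL psubset_imp_subset[OF LK] subK] by metis
  define P where "P = (I \<rightarrow>\<^sub>E T)"
  have finP: "finite P"
    unfolding P_def using I finite_subset[OF TK finite_subset[OF KG fin]]
    by (simp add: finite_PiE)
  define H where "H a = generate G (Y \<union> (\<lambda>i. a i \<otimes> z i) ` I \<union> L)" for a
  have P_K: "a i \<in> K" "a i \<in> carrier G" if "a \<in> P" "i \<in> I" for a i
    using that TK KG unfolding P_def by blast+
  have gens: "Y \<union> (\<lambda>i. a i \<otimes> z i) ` I \<union> L \<subseteq> carrier G" if "a \<in> P" for a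
    using Y LG P_K(2)[OF that] z by auto
  have subH: "subgroup (H a) G" if "a \<in> P" for a
    unfolding H_def using gens[OF that] by (rule generate_is_subgroup)
  have YH: "Y \<subseteq> H a" and azH: "\<And>i. i \<in> I \<Longrightarrow> a i \<otimes> z i \<in> H a" and LH: "L \<subseteq> H a" for a
    unfolding H_def by (blast intro: generate.incl)+
  have H_proper: "H a \<noteq> carrier G" if "a \<in> P" for a
  proof -
    have "a \<in> I \<rightarrow> K"
      using P_K(1)[OF that] by blast
    then show ?thesis
      using no_lift unfolding H_def by blast
  qed
  have KH: "K <#> H a = carrier G" if a: "a \<in> P" for a
  proof (rule set_mult_eq_carrierI[OF K subH[OF a] gen_z])
    have "z i \<in> K <#> H a" if i: "i \<in> I" for i
    proof -
      have "z i = inv (a i) \<otimes> (a i \<otimes> z i)"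
        using P_K(2)[OF a i] z i by (simp add: Pi_iff m_assoc[symmetric])
      then show ?thesis
        using subgroup.m_inv_closed[OF subK P_K(1)[OF a i]] azH[OF i]
        unfolding mem_set_mult_iff by blast
    qed
    then show "Y \<union> z ` I \<union> K \<subseteq> K <#> H a"
      using subset_set_mult1[OF KG subH[OF a]]
        subset_set_mult2[OF subK subgroup.subset[OF subH[OF a]]] YH by blast
  qed
  have K_Int_H: "K \<inter> H a = L" if a: "a \<in> P" for a
  proof -
    have "K \<inter> H a \<lhd> G"
      using der LH by (intro normal_Int_of_derived_subset K subH KH a) blast
    then have "K \<inter> H a = L \<or> K \<inter> H a = K"
      using chief LK LH by blast
    moreover have False if "K \<inter> H a = K"
    proof -
      have "K <#> H a \<subseteq> H a"
        using that mono_set_mult[of K "H a" "H a" "H a" G] subgroup_mult_id subH a by auto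
      then show False
        using KH H_proper a subgroup.subset[OF subH] by blast
    qed
    ultimately show ?thesis by blast
  qed
  \<comment> \<open>Write \<open>g i = k \<otimes> h\<close> and let \<open>t\<close> represent
    \<open>inv k\<close> modulo \<open>L\<close>. Then \<open>t \<otimes> k\<close> lies in
    \<open>L\<close>, so \<open>t \<otimes> g i\<close> differs from \<open>h\<close> by an element
    of \<open>H a\<close>.\<close>
  have "\<exists>t. t \<in> T \<and> t \<otimes> g i \<in> H a" if a: "a \<in> P" and i: "i \<in> I" for a i
  proof -
    obtain k h where kh: "k \<in> K" "h \<in> H a" "g i = k \<otimes> h"
      using g i KH[OF a] mem_set_mult_iff[of "g i" G K "H a"] by auto
    obtain t where t: "t \<in> T" "t \<otimes> inv (inv k) \<in> L"
      using T subgroup.m_inv_closed[OF subK kh(1)] by blast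
    have car: "k \<in> carrier G" "h \<in> carrier G" "t \<in> carrier G"
      using kh t TK KG subgroup.subset[OF subH[OF a]] by blast+
    have "t \<otimes> g i = (t \<otimes> k) \<otimes> h"
      using kh(3) car by (simp add: m_assoc)
    moreover have "t \<otimes> k \<in> H a"
      using t(2) car LH by auto
    ultimately show ?thesis
      using t(1) kh(2) subgroup.m_closed[OF subH[OF a]] by metis
  qed
  then have "\<exists>t. \<forall>a\<in>P. \<forall>i\<in>I. t a i \<in> T \<and> t a i \<otimes> g i \<in> H a"
    by metis
  then obtain t where t: "\<And>a i. a \<in> P \<Longrightarrow> i \<in> I \<Longrightarrow> t a i \<in> T"
    "\<And>a i. a \<in> P \<Longrightarrow> i \<in> I \<Longrightarrow> t a i \<otimes> g i \<in> H a"
    by metis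
  define b where "b a = restrict (t a) I" for a
  have b_P: "b ` P \<subseteq> P"
    using t(1) by (auto simp: b_def P_def)
  have H_eq: "H a \<subseteq> H a'" if a: "a \<in> P" and a': "a' \<in> P" and eq: "b a = b a'" for a a'
  proof -
    \<comment> \<open>\<open>R\<close> depends only on the tuple \<open>b a\<close> and lies in both
      \<open>H a\<close> and \<open>H a'\<close>. It already supplements \<open>K\<close>, so the
      modular law yields \<open>H a \<subseteq> R\<close>.\<close>
    define R where "R = generate G ((\<lambda>i. t a i \<otimes> g i) ` I \<union> L)"
    have t_eq: "t a i = t a' i" if "i \<in> I" for i
      using fun_cong[OF eq, of i] that by (simp add: b_def)
    have tcar: "t a i \<in> K" "t a i \<in> carrier G" if "i \<in> I" for i
      using t(1)[OF a that] TK KG by auto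
    have subR: "subgroup R G"
      unfolding R_def using tcar g LG by (intro generate_is_subgroup) auto
    have "t a i \<otimes> g i \<in> H a'" if "i \<in> I" for i
      using t(2)[OF a' that] t_eq[OF that] by simp
    then have RH: "R \<subseteq> H a" and RH': "R \<subseteq> H a'"
      unfolding R_def using t(2)[OF a] LH
      by (intro generate_subgroup_incl[OF _ subH] a a'; blast)+
    have KR: "K <#> R = carrier G"
    proof (rule set_mult_eq_carrierI[OF K subR gen_g], rule image_subsetI)
      fix i assume i: "i \<in> I"
      have "g i = inv (t a i) \<otimes> (t a i \<otimes> g i)"
        using tcar(2)[OF i] g i by (simp add: Pi_iff m_assoc[symmetric])
      moreover have "t a i \<otimes> g i \<in> R"
        unfolding R_def using i by (blast intro: generate.incl)
      ultimately show "g i \<in> K <#> R"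
        using subgroup.m_inv_closed[OF subK tcar(1)[OF i]]
        unfolding mem_set_mult_iff by blast
    qed
    have "L \<subseteq> R"
      unfolding R_def by (blast intro: generate.incl)
    then have "H a \<subseteq> R"
      using KR K_Int_H[OF a] subgroup.subset[OF subH[OF a]]
      by (intro modular_subgroup_subset[OF subH[OF a] subR RH _ _ KG]) auto
    then show ?thesis
      using RH' by blast
  qed
  \<comment> \<open>The common complement contains \<open>a i \<otimes> z i\<close> and
    \<open>a' i \<otimes> z i\<close>, so the quotient of \<open>a i\<close> by \<open>a' i\<close>
    lies in \<open>K \<inter> H a = L\<close>.\<close>
  have "inj_on b P"
  proof (rule inj_onI)
    fix a a' assume a: "a \<in> P" and a': "a' \<in> P" and eq: "b a = b a'"
    have HH: "H a = H a'"
      using H_eq[OF a a' eq] H_eq[OF a' a eq[symmetric]] by blast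
    have "a i = a' i" if i: "i \<in> I" for i
    proof -
      have car: "a i \<in> carrier G" "a' i \<in> carrier G" "z i \<in> carrier G"
        using P_K a a' i z by auto
      have "(a i \<otimes> z i) \<otimes> inv (a' i \<otimes> z i) \<in> H a"
        using azH[OF i, of a] azH[OF i, of a'] HH subH[OF a]
        by (auto intro!: subgroup.m_closed subgroup.m_inv_closed)
      moreover have "(a i \<otimes> z i) \<otimes> inv (a' i \<otimes> z i) = a i \<otimes> inv (a' i)"
        using car by (simp add: inv_mult_group m_assoc[symmetric])
          (simp add: m_assoc)
      moreover have "a i \<otimes> inv (a' i) \<in> K"
        using P_K(1) a a' i subK by (auto intro!: subgroup.m_closed subgroup.m_inv_closed)
      ultimately have "a i \<otimes> inv (a' i) \<in> L"
        using K_Int_H[OF a] by auto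
      then show ?thesis
        using T_unique a a' i unfolding P_def by blast
    qed
    then show "a = a'"
      using a a' unfolding P_def by (blast intro: PiE_ext)
  qed
  then have surj: "b ` P = P"
    using finP b_P by (intro endo_inj_surj)
  \<comment> \<open>\<open>e\<close> represents the trivial coset, as \<open>\<one>\<close> itself
    may be missing from \<open>T\<close>. Surjectivity puts the constant tuple \<open>e\<close> in
    the image of \<open>b\<close>, which forces all \<open>g i\<close> into a proper
    \<open>H a\<close>.\<close>
  obtain e where e: "e \<in> T" "e \<in> L"
    using T[OF subgroup.one_closed[OF subK]] TK KG by auto
  have "restrict (\<lambda>i. e) I \<in> P"
    using e by (simp add: P_def)
  then obtain a where a: "a \<in> P" "b a = restrict (\<lambda>i. e) I"
    using surj by (metis imageE)
  have "g i \<in> H a" if i: "i \<in> I" for i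
  proof -
    have "e \<otimes> g i \<in> H a"
      using t(2)[OF a(1) i] fun_cong[OF a(2), of i] i by (simp add: b_def)
    moreover have "e \<in> H a"
      using e LH by blast
    moreover have "g i = inv e \<otimes> (e \<otimes> g i)"
      using e LG g i by (simp add: Pi_iff m_assoc[symmetric] subsetD)
    ultimately show ?thesis
      using subH[OF a(1)] by (metis subgroup.m_closed subgroup.m_inv_closed)
  qed
  then have "carrier G \<subseteq> H a"
    using gen_g generate_subgroup_incl[OF _ subH[OF a(1)], of "g ` I"] by auto
  then show False
    using H_proper[OF a(1)] subgroup.subset[OF subH[OF a(1)]] by blast
qed

text \<open>Descend along a chief series below \<open>K\<close>: first lift modulo some
  \<open>L\<close> with \<open>K / L\<close> a chief factor, then apply the induction hypothesis to
  \<open>L\<close> and the corrected tuple. The two corrections multiply.\<close>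

theorem Gaschuetz_lift:
  fixes g z :: "'i \<Rightarrow> 'a"
  assumes fin: "finite (carrier G)" and sol: "solvable G" and I: "finite I"
    and g: "g \<in> I \<rightarrow> carrier G" and gen_g: "generate G (g ` I) = carrier G"
    and Y: "Y \<subseteq> carrier G"
    and "K \<lhd> G" and "z \<in> I \<rightarrow> carrier G" and "generate G (Y \<union> z ` I \<union> K) = carrier G"
  shows "\<exists>a\<in>I \<rightarrow> K. generate G (Y \<union> (\<lambda>i. a i \<otimes> z i) ` I) = carrier G"
  using assms(7-9)
proof (induction "card K" arbitrary: K z rule: less_induct)
  case less
  note K = \<open>K \<lhd> G\<close> and z = \<open>z \<in> I \<rightarrow> carrier G\<close>
  have subK: "subgroup K G"
    using K normal_imp_subgroup by blast
  then have KG: "K \<subseteq> carrier G"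
    by (rule subgroup.subset)
  have finK: "finite K"
    using KG fin finite_subset by blast
  show ?case
  proof (cases "K = {\<one>}")
    case True
    have z_eq: "(\<lambda>i. \<one> \<otimes> z i) ` I = z ` I"
      using z by (intro image_cong) (auto simp: Pi_iff)
    have sub: "Y \<union> z ` I \<subseteq> carrier G"
      using Y z by auto
    have "generate G (Y \<union> z ` I \<union> K) \<subseteq> generate G (Y \<union> z ` I)"
      unfolding True using generate_is_subgroup[OF sub]
      by (intro generate_subgroup_incl) (auto intro: generate.incl generate.one)
    then have "generate G (Y \<union> (\<lambda>i. \<one> \<otimes> z i) ` I) = carrier G"
      using less.prems(3) generate_incl[OF sub] unfolding z_eq by auto
    moreover have "(\<lambda>i. \<one>) \<in> I \<rightarrow> K"
      using True by simp
    ultimately show ?thesis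
      by (intro bexI[of _ "\<lambda>i. \<one>"])
  next
    case False
    \<comment> \<open>Solvability puts \<open>derived G K\<close> into this family, and a maximal
      member \<open>L\<close> makes \<open>K / L\<close> an abelian chief factor.\<close>
    define Ns where "Ns = {N. N \<lhd> G \<and> derived G K \<subseteq> N \<and> N \<subset> K}"
    have "derived G K \<in> Ns"
      using derived_psubset_of_solvable[OF sol subK False] derived_is_normal[OF K]
      by (simp add: Ns_def)
    moreover have "finite Ns"
      by (rule finite_subset[of _ "Pow K"]) (use finK in \<open>auto simp: Ns_def\<close>)
    ultimately obtain L where L: "L \<in> Ns" and max: "\<And>N. N \<in> Ns \<Longrightarrow> L \<subseteq> N \<Longrightarrow> N = L"
      using finite_has_maximal[of Ns] by (metis empty_iff)
    have "\<exists>a\<in>I \<rightarrow> K. generate G (Y \<union> (\<lambda>i. a i \<otimes> z i) ` I \<union> L) = carrier G"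
    proof (rule chief_factor_lift[OF fin I K _ _ _ _ g gen_g z Y less.prems(3)])
      show "L \<lhd> G" "L \<subset> K" "derived G K \<subseteq> L"
        using L by (auto simp: Ns_def)
      show "N = L \<or> N = K" if "N \<lhd> G" "L \<subseteq> N" "N \<subseteq> K" for N
        using max[of N] that L by (auto simp: Ns_def)
    qed
    then obtain a where a: "a \<in> I \<rightarrow> K"
      and gen_a: "generate G (Y \<union> (\<lambda>i. a i \<otimes> z i) ` I \<union> L) = carrier G"
      by blast
    have LK: "L \<lhd> G" "L \<subset> K"
      using L by (auto simp: Ns_def)
    have "(\<lambda>i. a i \<otimes> z i) \<in> I \<rightarrow> carrier G"
      using a z KG by auto
    from less.hyps[OF psubset_card_mono[OF finK LK(2)] LK(1) this gen_a]
    obtain c where c: "c \<in> I \<rightarrow> L"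
      and gen_c: "generate G (Y \<union> (\<lambda>i. c i \<otimes> (a i \<otimes> z i)) ` I) = carrier G"
      by blast
    have "(\<lambda>i. c i \<otimes> (a i \<otimes> z i)) ` I = (\<lambda>i. (c i \<otimes> a i) \<otimes> z i) ` I"
    proof (rule image_cong)
      fix i assume "i \<in> I"
      then have "a i \<in> carrier G" "c i \<in> carrier G" "z i \<in> carrier G"
        using a c z KG LK(2) by auto
      then show "c i \<otimes> (a i \<otimes> z i) = (c i \<otimes> a i) \<otimes> z i"
        by (simp add: m_assoc)
    qed simp
    moreover have "(\<lambda>i. c i \<otimes> a i) \<in> I \<rightarrow> K"
      using a c LK(2) subgroup.m_closed[OF subK] by blast
    ultimately show ?thesis
      using gen_c by (intro bexI[of _ "\<lambda>i. c i \<otimes> a i"]) simp_all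
  qed
qed

section \<open>Completing an element outside a maximal subgroup to a generating set\<close>

text \<open>Such a \<open>z\<close> separates \<open>y\<close> from every \<open>x \<in> M\<close>,
  since \<open>x\<close> and the \<open>z i\<close> generate only a subgroup of
  \<open>M\<close>.\<close>

lemma maximal_subgroup_supplement:
  fixes g :: "'i \<Rightarrow> 'a"
  assumes fin: "finite (carrier G)" and sol: "solvable G" and I: "finite I"
    and g: "g \<in> I \<rightarrow> carrier G" and gen_g: "generate G (g ` I) = carrier G"
    and M: "maximal_subgroup M G" and y: "y \<in> carrier G" "y \<notin> M"
  shows "\<exists>z\<in>I \<rightarrow> M. generate G (insert y (z ` I)) = carrier G"
proof -
  have subM: "subgroup M G" and M_ne: "M \<noteq> carrier G"
    and M_max: "\<And>H. subgroup H G \<Longrightarrow> M \<subseteq> H \<Longrightarrow> H = M \<or> H = carrier G"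
    using M by (auto simp: maximal_subgroup_def)
  have MG: "M \<subseteq> carrier G"
    using subM by (rule subgroup.subset)
  define Ns where "Ns = {N. N \<lhd> G \<and> \<not> N \<subseteq> M}"
  have "carrier G \<in> Ns"
    using normal_self M_ne MG by (auto simp: Ns_def)
  moreover have "finite Ns"
    by (rule finite_subset[of _ "Pow (carrier G)"])
      (use fin in \<open>auto simp: Ns_def dest!: normal_imp_subgroup subgroup.subset\<close>)
  ultimately obtain N where N: "N \<lhd> G" "\<not> N \<subseteq> M"
    and min: "\<And>N'. N' \<in> Ns \<Longrightarrow> N' \<subseteq> N \<Longrightarrow> N' = N"
    using finite_has_minimal[of Ns] by (metis (mono_tags, lifting) Ns_def empty_iff mem_Collect_eq)
  have subN: "subgroup N G"
    using N(1) normal_imp_subgroup by blast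
  then have NG: "N \<subseteq> carrier G"
    by (rule subgroup.subset)
  have NM: "N <#> M = carrier G"
    using M_max[OF mult_norm_subgroup[OF N(1) subM] subset_set_mult2[OF subN MG]]
      subset_set_mult1[OF NG subM] N(2) by blast
  have "N \<noteq> {\<one>}"
    using N(2) subgroup.one_closed[OF subM] by blast
  then have "derived G N \<subset> N"
    by (rule derived_psubset_of_solvable[OF sol subN])
  then have "derived G N \<subseteq> M"
    using min[of "derived G N"] derived_is_normal[OF N(1)] by (auto simp: Ns_def)
  then have K: "N \<inter> M \<lhd> G"
    using N(1) subM NM by (intro normal_Int_of_derived_subset)
  have "\<exists>n m. n \<in> N \<and> m \<in> M \<and> g i = n \<otimes> m" if "i \<in> I" for i
    using g that NM mem_set_mult_iff[of "g i" G N M] by auto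
  then obtain n m where nm: "\<And>i. i \<in> I \<Longrightarrow> n i \<in> N" "\<And>i. i \<in> I \<Longrightarrow> m i \<in> M"
    "\<And>i. i \<in> I \<Longrightarrow> g i = n i \<otimes> m i"
    by metis
  have mG: "m \<in> I \<rightarrow> carrier G"
    using nm(2) MG by blast
  \<comment> \<open>In fact \<open>R = M\<close>: it supplements \<open>N\<close> because
    \<open>g i = n i \<otimes> m i\<close>, and it contains \<open>N \<inter> M\<close>, so the
    modular law applies. Adding \<open>y\<close> then gives \<open>G\<close> by maximality.\<close>
  define R where "R = generate G (m ` I \<union> (N \<inter> M))"
  have subR: "subgroup R G"
    unfolding R_def using mG MG by (intro generate_is_subgroup) auto
  have "N <#> R = carrier G"
  proof (rule set_mult_eq_carrierI[OF N(1) subR gen_g], rule image_subsetI)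
    fix i assume i: "i \<in> I"
    have "m i \<in> R"
      unfolding R_def using i by (blast intro: generate.incl)
    then show "g i \<in> N <#> R"
      using nm i unfolding mem_set_mult_iff by blast
  qed
  moreover have "R \<subseteq> M"
    unfolding R_def using nm(2) subM by (intro generate_subgroup_incl) auto
  moreover have "N \<inter> M \<subseteq> R"
    unfolding R_def by (blast intro: generate.incl)
  ultimately have MR: "M \<subseteq> R"
    using MG by (intro modular_subgroup_subset[OF subM subR _ _ _ NG]) auto
  define S where "S = generate G ({y} \<union> m ` I \<union> (N \<inter> M))"
  have subS: "subgroup S G"
    unfolding S_def using mG MG y(1) by (intro generate_is_subgroup) auto
  have "R \<subseteq> S"
    unfolding R_def S_def by (intro mono_generate) auto
  then have "M \<subseteq> S"
    using MR by blast
  moreover have "y \<in> S"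
    unfolding S_def by (blast intro: generate.incl)
  ultimately have "S = carrier G"
    using M_max[OF subS] y(2) by blast
  then obtain a where a: "a \<in> I \<rightarrow> N \<inter> M"
    and gen: "generate G ({y} \<union> (\<lambda>i. a i \<otimes> m i) ` I) = carrier G"
    using Gaschuetz_lift[OF fin sol I g gen_g _ K mG, of "{y}"] y(1) unfolding S_def by blast
  have "(\<lambda>i. a i \<otimes> m i) \<in> I \<rightarrow> M"
    using a nm(2) subgroup.m_closed[OF subM] by blast
  then show ?thesis
    using gen by auto
qed

section \<open>Maximal subgroups and the equivalence relations\<close>

lemma proper_subgroup_le_maximal:
  assumes "finite (carrier G)" "subgroup H G" "H \<noteq> carrier G"
  shows "\<exists>M. maximal_subgroup M G \<and> H \<subseteq> M"
proof -
  define Hs where "Hs = {U. subgroup U G \<and> U \<noteq> carrier G}"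
  have "finite Hs"
    by (rule finite_subset[of _ "Pow (carrier G)"])
      (use assms(1) in \<open>auto simp: Hs_def dest: subgroup.subset\<close>)
  moreover have "H \<in> Hs"
    using assms by (simp add: Hs_def)
  ultimately obtain M where "M \<in> Hs" "H \<subseteq> M" "\<And>U. U \<in> Hs \<Longrightarrow> M \<subseteq> U \<Longrightarrow> M = U"
    using finite_has_maximal2[of Hs H] by metis
  then show ?thesis
    unfolding Hs_def maximal_subgroup_def by blast
qed

lemma generate_eq_carrier_iff_maximal:
  assumes "finite (carrier G)" "A \<subseteq> carrier G"
  shows "generate G A = carrier G \<longleftrightarrow> (\<forall>M. maximal_subgroup M G \<longrightarrow> \<not> A \<subseteq> M)"
proof
  assume gen: "generate G A = carrier G"
  show "\<forall>M. maximal_subgroup M G \<longrightarrow> \<not> A \<subseteq> M"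
  proof (intro allI impI notI)
    fix M assume M: "maximal_subgroup M G" and "A \<subseteq> M"
    then have "carrier G \<subseteq> M"
      using generate_subgroup_incl gen by (metis maximal_subgroup_def)
    then show False
      using M subgroup.subset by (auto simp: maximal_subgroup_def)
  qed
next
  assume *: "\<forall>M. maximal_subgroup M G \<longrightarrow> \<not> A \<subseteq> M"
  have "A \<subseteq> generate G A"
    by (blast intro: generate.incl)
  then show "generate G A = carrier G"
    using proper_subgroup_le_maximal[OF assms(1) generate_is_subgroup[OF assms(2)]] *
    by (meson order_trans)
qed

text \<open>Whether a set generates depends only on the maximal subgroups containing it, and
  exchanging \<open>x\<close> for \<open>y\<close> does not alter these.\<close>

lemma equiv_max_imp_equiv_max_r:
  assumes fin: "finite (carrier G)" and eq: "equiv_max G x y"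
  shows "equiv_max_r G r x y"
  unfolding equiv_max_r_def
proof (intro conjI allI impI)
  show x: "x \<in> carrier G" and y: "y \<in> carrier G"
    using eq by (auto simp: equiv_max_def)
  fix zs assume "set zs \<subseteq> carrier G \<and> length zs = r - 1"
  then have "insert x (set zs) \<subseteq> carrier G" "insert y (set zs) \<subseteq> carrier G"
    using x y by auto
  then show "generate G (insert x (set zs)) = carrier G \<longleftrightarrow>
      generate G (insert y (set zs)) = carrier G"
    using eq by (simp add: generate_eq_carrier_iff_maximal[OF fin] equiv_max_def)
qed

lemma equiv_max_r_mem_maximal:
  assumes fin: "finite (carrier G)" and sol: "solvable G"
    and S: "S \<subseteq> carrier G" "generate G S = carrier G"
    and eq: "equiv_max_r G (card S + 1) x y" and M: "maximal_subgroup M G" and x: "x \<in> M"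
  shows "y \<in> M"
proof (rule ccontr)
  assume y: "y \<notin> M"
  have finS: "finite S"
    using S(1) fin finite_subset by blast
  obtain ss where ss: "set ss = S" "distinct ss"
    using finite_distinct_list[OF finS] by blast
  have yG: "y \<in> carrier G"
    using eq by (simp add: equiv_max_r_def)
  \<comment> \<open>The generators are indexed by themselves.\<close>
  have "(\<lambda>s. s) \<in> S \<rightarrow> carrier G"
    using S(1) by blast
  from maximal_subgroup_supplement[OF fin sol finS this _ M yG y]
  obtain z where z: "z \<in> S \<rightarrow> M" "generate G (insert y (z ` S)) = carrier G"
    using S(2) by auto
  have subM: "subgroup M G" and M_ne: "M \<noteq> carrier G"
    using M by (auto simp: maximal_subgroup_def)
  \<comment> \<open>Mapping over a list keeps the length \<open>card S\<close> even if
    \<open>z\<close> is not injective; this is \<open>r - 1\<close> for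
    \<open>r = card S + 1\<close>.\<close>
  have "set (map z ss) \<subseteq> carrier G" "length (map z ss) = card S + 1 - 1"
    using z(1) subgroup.subset[OF subM] ss distinct_card[of ss] by auto
  then have "generate G (insert x (set (map z ss))) = carrier G"
    using eq z(2) ss(1) unfolding equiv_max_r_def by (metis set_map)
  moreover have "generate G (insert x (set (map z ss))) \<subseteq> M"
    using z(1) x ss(1) subM by (intro generate_subgroup_incl) auto
  ultimately show False
    using M_ne subgroup.subset[OF subM] by blast
qed

end

theorem corollary2p12:
  fixes G :: "('a, 'b) monoid_scheme"
  assumes "group G" and "finite (carrier G)" and "solvable G"
  shows "psi G \<le> min_generators G + 1"
proof -
  interpret group G by fact
  have "\<exists>n. \<exists>S \<subseteq> carrier G. finite S \<and> card S = n \<and> generate G S = carrier G"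
    using assms(2) generate_incl[of "carrier G"] generate.incl[of _ "carrier G" G] by blast
  from LeastI_ex[OF this]
  obtain S where S: "S \<subseteq> carrier G" "generate G S = carrier G" "card S = min_generators G"
    unfolding min_generators_def by blast
  have "equiv_max_r G (card S + 1) x y \<longleftrightarrow> equiv_max G x y" for x y
  proof
    assume eq: "equiv_max_r G (card S + 1) x y"
    \<comment> \<open>Symmetry lets the one-sided transfer of membership run in both
      directions.\<close>
    then have "equiv_max_r G (card S + 1) y x"
      by (auto simp: equiv_max_r_def)
    with eq show "equiv_max G x y"
      using equiv_max_r_mem_maximal[OF assms(2,3) S(1,2)]
      unfolding equiv_max_def equiv_max_r_def by metis
  next
    assume "equiv_max G x y"
    then show "equiv_max_r G (card S + 1) x y"
      by (rule equiv_max_imp_equiv_max_r[OF assms(2)])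
  qed
  then have "equiv_max_r G (min_generators G + 1) = equiv_max G"
    unfolding S(3) by (intro ext)
  then show ?thesis
    unfolding psi_def by (intro Least_le) simp
qed

end
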